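(* For any integers $2 \leq a \leq b$ there exists a graph $G$ with $\mathrm{mp}(G) = a$ and $\mathrm{gp}(G) = b$.
   Context: All graphs are finite, simple and undirected. A path $P$ in $G$ is monophonic (induced) if $G$ contains no edge between vertices that are non-consecutive on $P$. A set $M \subseteq V(G)$ is a monophonic position set if no three vertices of $M$ lie on a common monophonic path in $G$; $\mathrm{mp}(G)$ is the number of vertices in a largest monophonic position set. A set $S \subseteq V(G)$ is a general position set if no shortest path of $G$ contains more than two vertices of $S$; $\mathrm{gp}(G)$ is the number of vertices in a largest general position set. *)

theory Defs
  imports "Graph_Theory.Pair_Digraph" "Graph_Theory.Vertex_Walk"
begin

text \<open>
  As in the AFP entry Graph Theory, a finite simple undirected graph is a finite symmetric
  digraph without loops and parallel arcs (locale \<^locale>\<open>graph\<close>, or \<^locale>\<open>pair_graph\<close> when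
  the arcs are pairs of vertices). A path is a nonempty list of distinct vertices
  (\<^const>\<open>vpath\<close>). The notions below are meant for such graphs, which need not be connected.
\<close>

definition monophonic_path :: "('a, 'b) pre_digraph \<Rightarrow> 'a list \<Rightarrow> bool" where
  "monophonic_path G p \<longleftrightarrow> vpath p G \<and>
     (\<forall>i < length p. \<forall>j < length p. p ! i \<rightarrow>\<^bsub>G\<^esub> p ! j \<longrightarrow> j = i + 1 \<or> i = j + 1)"

definition shortest_path :: "('a, 'b) pre_digraph \<Rightarrow> 'a list \<Rightarrow> bool" where
  "shortest_path G p \<longleftrightarrow> vpath p G \<and>
     (\<forall>q. vpath q G \<and> hd q = hd p \<and> last q = last p \<longrightarrow> vwalk_length p \<le> vwalk_length q)"

definition monophonic_position_set :: "('a, 'b) pre_digraph \<Rightarrow> 'a set \<Rightarrow> bool" where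
  "monophonic_position_set G M \<longleftrightarrow> M \<subseteq> verts G \<and>
     \<not> (\<exists>x\<in>M. \<exists>y\<in>M. \<exists>z\<in>M. x \<noteq> y \<and> y \<noteq> z \<and> x \<noteq> z \<and>
          (\<exists>p. monophonic_path G p \<and> {x, y, z} \<subseteq> set p))"

definition general_position_set :: "('a, 'b) pre_digraph \<Rightarrow> 'a set \<Rightarrow> bool" where
  "general_position_set G S \<longleftrightarrow> S \<subseteq> verts G \<and>
     \<not> (\<exists>p. shortest_path G p \<and> card (set p \<inter> S) > 2)"

text \<open>
  For a finite vertex set the maxima range over a finite set of numbers, which is nonempty
  because the empty set of vertices is in monophonic and in general position.
\<close>

definition mp_number :: "('a, 'b) pre_digraph \<Rightarrow> nat" where
  "mp_number G = Max (card ` {M. monophonic_position_set G M})"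

definition gp_number :: "('a, 'b) pre_digraph \<Rightarrow> nat" where
  "gp_number G = Max (card ` {S. general_position_set G S})"

end

theory Submission
  imports Defs
begin

text \<open>
  The witness for \<open>a < b\<close> is a crown graph \<open>K\<^sub>n\<^sub>,\<^sub>n\<close> minus a perfect matching, with \<open>n = b - a + 2\<close>,
  together with \<open>a - 2\<close> isolated vertices, each of which adds one to both numbers. Any two vertices
  on one side of the crown and one vertex on the other side lie on a common geodesic, so a
  set in general position with more than two vertices stays on one side. A side is in general
  position, since the crown has diameter 3 and its paths alternate between the sides. Three
  vertices \<open>u, v, w\<close> on one side still lie on an induced path \<open>u, v', w, u', v\<close>, where primes denote
  matched vertices; hence the crown has monophonic position number 2.
\<close>

section \<open>The crown graph with isolated vertices\<close>

text \<open>The sides are the even and the odd numbers below \<open>2 * n\<close>, and \<open>2 * i\<close> is matched with \<open>2 * i + 1\<close>.\<close>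

definition crown :: "nat \<Rightarrow> nat \<Rightarrow> nat pair_pre_digraph" where
  "crown n m = \<lparr>pverts = {..<2 * n + m},
     parcs = {(u, v). u < 2 * n \<and> v < 2 * n \<and> even u \<noteq> even v \<and> u div 2 \<noteq> v div 2}\<rparr>"

lemma pverts_crown [simp]: "pverts (crown n m) = {..<2 * n + m}"
  by (simp add: crown_def)

lemma parcs_crown [simp]:
  "(u, v) \<in> parcs (crown n m) \<longleftrightarrow>
     u < 2 * n \<and> v < 2 * n \<and> even u \<noteq> even v \<and> u div 2 \<noteq> v div 2"
  by (simp add: crown_def)

lemma pair_graph_crown: "pair_graph (crown n m)"
proof
  show "finite (parcs (crown n m))"
    by (rule finite_subset[of _ "{..<2 * n} \<times> {..<2 * n}"]) auto
  show "symmetric (with_proj (crown n m))"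
    by (auto simp: symmetric_def intro!: symI)
qed auto

text \<open>\<open>P\<close> is left open so that one argument about the maximum serves both
  position numbers.\<close>

lemma position_number_eqI:
  assumes "finite (verts G)" "\<And>S. P S \<Longrightarrow> S \<subseteq> verts G"
    and "P T" "card T = k" "\<And>S. P S \<Longrightarrow> card S \<le> k"
  shows "Max (card ` {S. P S}) = k"
proof (rule Max_eqI)
  have "{S. P S} \<subseteq> Pow (verts G)"
    using assms(2) by blast
  then show "finite (card ` {S. P S})"
    using assms(1) by (metis finite_Pow_iff finite_imageI finite_subset)
qed (use assms in auto)

section \<open>Walks and distances in the crown\<close>

text \<open>Every arc has both ends in the crown, so only a one-vertex walk can meet an isolated
  vertex.\<close>

lemma vwalk_crown_cases:
  assumes "vwalk p (with_proj (crown n m))"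
  shows "length p \<le> 1 \<or> set p \<subseteq> {..<2 * n}"
  using assms by (induction p rule: vwalk_induct) auto

text \<open>Arcs join opposite parities, so a walk never has two even vertices in a row.\<close>

lemma vwalk_crown_even:
  assumes "vwalk p (with_proj (crown n m))"
  shows "2 * length (filter even p) \<le> length p + 1"
proof -
  \<comment> \<open>For the induction to pass, the extra 1 is granted only when the first vertex is
    even.\<close>
  have "2 * length (filter even p) \<le> length p + (if even (hd p) then 1 else 0)"
    using assms by (induction p rule: vwalk_induct) (auto split: if_splits)
  then show ?thesis
    by (auto split: if_splits)
qed

text \<open>Among three matched pairs, two forbidden ones leave a third, which has a vertex on
  either side.\<close>

lemma crown_vertex_exists:
  fixes n i j :: nat
  assumes "3 \<le> n"
  obtains w where "w < 2 * n" "even w = s" "w div 2 \<noteq> i" "w div 2 \<noteq> j"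
proof -
  have "\<exists>l<3. l \<noteq> i \<and> l \<noteq> j"
    by presburger
  then obtain l where l: "l < 3" "l \<noteq> i" "l \<noteq> j"
    by blast
  show thesis
    using that[of "2 * l + (if s then 0 else 1)"] l assms by auto
qed

lemma eq_if_half_parity_eq: "even u = even v \<Longrightarrow> u div 2 = v div 2 \<Longrightarrow> u = v" for u v :: nat
  by (metis bit_eq_rec)

text \<open>\<open>length\<close> counts vertices, so distances are at most 3. This limits every
  geodesic in the crown to four vertices.\<close>

lemma crown_diameter:
  assumes n: "3 \<le> n" and uv: "u < 2 * n" "v < 2 * n"
  obtains q where "vpath q (with_proj (crown n m))" "hd q = u" "last q = v" "length q \<le> 4"
proof (cases "even u = even v")
  case True
  show thesis
  proof (cases "u = v")
    case True
    then show thesis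
      using that[of "[u]"] uv by (auto simp: vpath_def vwalk_def)
  next
    case False
    obtain w where "w < 2 * n" "even w = (\<not> even u)" "w div 2 \<noteq> u div 2" "w div 2 \<noteq> v div 2"
      using n by (rule crown_vertex_exists)
    then show thesis
      using that[of "[u, w, v]"] uv True False by (auto simp: vpath_def vwalk_def)
  qed
next
  case parity: False
  show thesis
  proof (cases "u div 2 = v div 2")
    case True
    \<comment> \<open>Matched vertices have neither an arc nor a common neighbour, so two
      intermediate vertices are required.\<close>
    obtain k where k: "k < 2 * n" "even k = even v" "k div 2 \<noteq> u div 2"
      using crown_vertex_exists[OF n] by metis
    obtain l where l: "l < 2 * n" "even l = even u" "l div 2 \<noteq> v div 2" "l div 2 \<noteq> k div 2"
      using n by (rule crown_vertex_exists)
    show thesis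
      using that[of "[u, k, l, v]"] uv k l True parity by (auto simp: vpath_def vwalk_def)
  next
    case False
    then show thesis
      using that[of "[u, v]"] uv parity by (auto simp: vpath_def vwalk_def)
  qed
qed

section \<open>Geodesics and induced paths through three crown vertices\<close>

lemma shortest_pathI:
  assumes "vpath p G"
    and "\<And>q. vpath q G \<Longrightarrow> hd q = hd p \<Longrightarrow> last q = last p \<Longrightarrow> length p \<le> length q"
  shows "shortest_path G p"
  using assms by (simp add: shortest_path_def diff_le_mono)

text \<open>If \<open>w\<close> is adjacent to both \<open>u\<close> and \<open>v\<close>, the path
  through \<open>w\<close> works. Otherwise \<open>w\<close> is matched with one of them, hence at
  distance 3 from it, and the other one fits on a geodesic between the two. The path is also
  induced, so it serves both position numbers.\<close>

lemma crown_geodesic: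
  assumes n: "3 \<le> n" and uvw: "u < 2 * n" "v < 2 * n" "w < 2 * n"
    and neq: "u \<noteq> v" and parity: "even u = even v" "even w \<noteq> even u"
  shows "\<exists>p. shortest_path (with_proj (crown n m)) p \<and>
    monophonic_path (with_proj (crown n m)) p \<and> {u, v, w} \<subseteq> set p"
proof -
  let ?G = "with_proj (crown n m)"
  have half: "u div 2 \<noteq> v div 2"
    using eq_if_half_parity_eq neq parity(1) by blast
  have matched: "\<exists>p. shortest_path ?G p \<and> monophonic_path ?G p \<and> {x, y, w} \<subseteq> set p"
    if w: "w div 2 = x div 2" and xy: "x < 2 * n" "y < 2 * n" "even w \<noteq> even x" "even x = even y"
      "x div 2 \<noteq> y div 2" for x y
  proof -
    obtain k where k: "k < 2 * n" "even k = even w" "k div 2 \<noteq> x div 2" "k div 2 \<noteq> y div 2"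
      using n by (rule crown_vertex_exists)
    have path: "vpath [x, k, y, w] ?G"
      using k w xy uvw by (cases "even x") (auto simp: vpath_def vwalk_def)
    have min: "length [x, k, y, w] \<le> length q" if q: "vpath q ?G" "hd q = x" "last q = w" for q
    proof (rule ccontr)
      assume "\<not> length [x, k, y, w] \<le> length q"
      moreover have "q \<noteq> []"
        using q(1) by auto
      \<comment> \<open>These three fail by parity, by the matching, and by parity again.\<close>
      ultimately consider "q = [x]" "x = w" | "q = [x, w]" | c where "q = [x, c, w]"
        using q(2,3) by (cases q; cases "tl q"; cases "tl (tl q)") (auto simp: not_le)
      then show False
        by cases (use q(1) w xy(3) in \<open>auto simp: vpath_def vwalk_def\<close>)
    qed
    have "shortest_path ?G [x, k, y, w]"
      using path min by (intro shortest_pathI) simp_all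
    moreover have "monophonic_path ?G [x, k, y, w]"
      unfolding monophonic_path_def using path k w xy
      by (cases "even x") (simp_all add: All_less_Suc)
    ultimately show ?thesis
      by force
  qed
  consider "w div 2 = u div 2" | "w div 2 = v div 2" | "w div 2 \<noteq> u div 2" "w div 2 \<noteq> v div 2"
    by blast
  then show ?thesis
  proof cases
    case 1
    then show ?thesis
      using matched[of u v] uvw parity half by blast
  next
    case 2
    then have "\<exists>p. shortest_path ?G p \<and> monophonic_path ?G p \<and> {v, u, w} \<subseteq> set p"
      using matched[of v u] uvw parity half by metis
    then show ?thesis
      by (simp add: insert_commute)
  next
    case 3
    have path: "vpath [u, w, v] ?G"
      using 3 uvw neq parity by (auto simp: vpath_def vwalk_def)
    have min: "length [u, w, v] \<le> length q" if q: "vpath q ?G" "hd q = u" "last q = v" for q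
    proof (rule ccontr)
      assume "\<not> length [u, w, v] \<le> length q"
      moreover have "q \<noteq> []"
        using q(1) by auto
      ultimately consider "u = v" | "q = [u, v]"
        using q(2,3) by (cases q; cases "tl q") (auto simp: not_le)
      then show False
        by cases (use q(1) neq parity(1) in \<open>auto simp: vpath_def vwalk_def\<close>)
    qed
    have "shortest_path ?G [u, w, v]"
      using path min by (intro shortest_pathI) simp_all
    moreover have "monophonic_path ?G [u, w, v]"
      unfolding monophonic_path_def using path parity
      by (simp add: All_less_Suc)
    ultimately show ?thesis
      by force
  qed
qed

text \<open>Unless all three lie on one side, two share a side opposite to the third, and the
  geodesic above applies.\<close>

lemma crown_monophonic_path:
  assumes n: "3 \<le> n" and uvw: "u < 2 * n" "v < 2 * n" "w < 2 * n"
    and neq: "u \<noteq> v" "v \<noteq> w" "u \<noteq> w"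
  shows "\<exists>p. monophonic_path (with_proj (crown n m)) p \<and> {u, v, w} \<subseteq> set p"
proof -
  let ?G = "with_proj (crown n m)"
  consider "even u = even v" "even v = even w" | "even u = even v" "even w \<noteq> even u"
    | "even u = even w" "even v \<noteq> even u" | "even v = even w" "even u \<noteq> even v"
    by blast
  then show ?thesis
  proof cases
    case 1
    have half: "u div 2 \<noteq> v div 2" "v div 2 \<noteq> w div 2" "u div 2 \<noteq> w div 2"
      using eq_if_half_parity_eq neq 1 by metis+
    have mate: "\<exists>y < 2 * n. y div 2 = x div 2 \<and> even y \<noteq> even x" if "x < 2 * n" for x :: nat
      using that
      by (intro exI[of _ "if even x then x + 1 else x - 1"]) (auto elim!: evenE oddE)
    obtain v' where v': "v' < 2 * n" "v' div 2 = v div 2" "even v' \<noteq> even v"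
      using mate uvw(2) by blast
    obtain u' where u': "u' < 2 * n" "u' div 2 = u div 2" "even u' \<noteq> even u"
      using mate uvw(1) by blast
    \<comment> \<open>The only non-consecutive vertices on opposite sides are \<open>u\<close>,
      \<open>u'\<close> and \<open>v'\<close>, \<open>v\<close>; both pairs are matched, hence not
      adjacent.\<close>
    have "monophonic_path ?G [u, v', w, u', v]"
      unfolding monophonic_path_def vpath_def vwalk_def using uvw half 1 u' v' neq
      by (cases "even u") (auto simp: All_less_Suc)
    then show ?thesis
      by force
  next
    case 2
    then show ?thesis
      using crown_geodesic[OF n, of u v w m] uvw neq by blast
  next
    case 3
    then show ?thesis
      using crown_geodesic[OF n, of u w v m] uvw neq by blast
  next
    case 4
    then show ?thesis
      using crown_geodesic[OF n, of v w u m] uvw neq by blast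
  qed
qed

section \<open>Counting vertices of position sets\<close>

text \<open>Splitting off the isolated vertices leaves only the crown part of a position set to be
  bounded.\<close>

lemma card_le_crown_part:
  assumes "S \<subseteq> {..<2 * n + m}"
  shows "card S \<le> card (S \<inter> {..<2 * n}) + m"
proof -
  have "card S \<le> card ((S \<inter> {..<2 * n}) \<union> {2 * n..<2 * n + m})"
    using assms by (intro card_mono) auto
  also have "\<dots> \<le> card (S \<inter> {..<2 * n}) + m"
    using card_Un_le[of "S \<inter> {..<2 * n}" "{2 * n..<2 * n + m}"] by simp
  finally show ?thesis .
qed

lemma obtain_three:
  assumes "2 < card A"
  obtains x y z where "x \<in> A" "y \<in> A" "z \<in> A" "x \<noteq> y" "y \<noteq> z" "x \<noteq> z"
proof -
  have "3 \<le> card A"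
    using assms by simp
  then obtain T where "T \<subseteq> A" "card T = 3"
    using obtain_subset_with_card_n by metis
  then show thesis
    using that by (auto simp: card_3_iff)
qed

lemma monophonic_position_setI:
  assumes "M \<subseteq> verts G" and "\<And>p. monophonic_path G p \<Longrightarrow> card (set p \<inter> M) \<le> 2"
  shows "monophonic_position_set G M"
proof -
  have False if "x \<in> M" "y \<in> M" "z \<in> M" "x \<noteq> y" "y \<noteq> z" "x \<noteq> z"
    "monophonic_path G p" "{x, y, z} \<subseteq> set p" for x y z p
  proof -
    have "card {x, y, z} \<le> card (set p \<inter> M)"
      using that by (intro card_mono) auto
    then show False
      using that assms(2)[of p] by simp
  qed
  then show ?thesis
    using assms(1) unfolding monophonic_position_set_def by meson
qed

section \<open>The two numbers of the crown\<close>

lemma mp_number_crown: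
  assumes n: "3 \<le> n"
  shows "mp_number (with_proj (crown n m)) = m + 2"
  unfolding mp_number_def
proof (rule position_number_eqI[where G = "with_proj (crown n m)"])
  let ?G = "with_proj (crown n m)"
  \<comment> \<open>A path inside the crown meets \<open>?T\<close> in at most \<open>0\<close> and
    \<open>1\<close>; any other path has a single vertex.\<close>
  let ?T = "{0, 1} \<union> {2 * n..<2 * n + m}"
  show "monophonic_position_set ?G ?T"
  proof (rule monophonic_position_setI)
    fix p
    assume "monophonic_path ?G p"
    then have "vwalk p ?G"
      by (simp add: monophonic_path_def vpath_def)
    then consider "length p \<le> 1" | "set p \<subseteq> {..<2 * n}"
      using vwalk_crown_cases by blast
    then show "card (set p \<inter> ?T) \<le> 2"
    proof cases
      case 1
      then show ?thesis
        using card_length[of p] card_mono[of "set p" "set p \<inter> ?T"] by simp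
    next
      case 2
      then have "card (set p \<inter> ?T) \<le> card {0, 1 :: nat}"
        by (intro card_mono) auto
      then show ?thesis
        by simp
    qed
  qed (use n in auto)
  show "card ?T = m + 2"
    using n by (subst card_Un_disjoint) auto
  fix S
  assume S: "monophonic_position_set ?G S"
  have "card (S \<inter> {..<2 * n}) \<le> 2"
  proof (rule ccontr)
    assume "\<not> card (S \<inter> {..<2 * n}) \<le> 2"
    then obtain u v w where "u \<in> S \<inter> {..<2 * n}" "v \<in> S \<inter> {..<2 * n}" "w \<in> S \<inter> {..<2 * n}"
      "u \<noteq> v" "v \<noteq> w" "u \<noteq> w"
      using obtain_three by (metis not_le)
    then show False
      using S crown_monophonic_path[OF n, of u v w m]
      unfolding monophonic_position_set_def by blast
  qed
  then show "card S \<le> m + 2"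
    using card_le_crown_part[of S n m] S by (simp add: monophonic_position_set_def)
qed (auto simp: monophonic_position_set_def)

lemma gp_number_crown:
  assumes n: "3 \<le> n"
  shows "gp_number (with_proj (crown n m)) = m + n"
  unfolding gp_number_def
proof (rule position_number_eqI[where G = "with_proj (crown n m)"])
  let ?G = "with_proj (crown n m)"
  let ?T = "(\<lambda>i. 2 * i) ` {..<n} \<union> {2 * n..<2 * n + m}"
  show "general_position_set ?G ?T"
    unfolding general_position_set_def
  proof (intro conjI notI)
    assume "\<exists>p. shortest_path ?G p \<and> card (set p \<inter> ?T) > 2"
    then obtain p where p: "shortest_path ?G p" "card (set p \<inter> ?T) > 2"
      by blast
    have walk: "vwalk p ?G"
      using p(1) by (simp add: shortest_path_def vpath_def)
    have "2 < length p"
      using p(2) card_length[of p] card_mono[of "set p" "set p \<inter> ?T"] by simp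
    then have crown: "set p \<subseteq> {..<2 * n}"
      using vwalk_crown_cases[OF walk] by auto
    have "p \<noteq> []"
      using walk by auto
    then have "hd p < 2 * n" "last p < 2 * n"
      using crown by (meson hd_in_set last_in_set lessThan_iff subsetD)+
    then obtain q where q: "vpath q ?G" "hd q = hd p" "last q = last p" "length q \<le> 4"
      by (rule crown_diameter[OF n])
    then have "length p - 1 \<le> length q - 1"
      using p(1) by (simp add: shortest_path_def)
    then have "length p \<le> 4"
      using q(4) by linarith
    have "set p \<inter> ?T \<subseteq> {x \<in> set p. even x}"
      using crown by auto
    then have "card (set p \<inter> ?T) \<le> card {x \<in> set p. even x}"
      by (intro card_mono) auto
    also have "\<dots> \<le> length (filter even p)"
      by (metis card_length set_filter)
    \<comment> \<open>For \<open>k\<close> even vertices among at most four,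
      \<open>2 * k \<le> 5\<close> and hence \<open>k \<le> 2\<close>.\<close>
    also have "\<dots> \<le> 2"
      using vwalk_crown_even[OF walk] \<open>length p \<le> 4\<close> by simp
    finally show False
      using p(2) by simp
  qed auto
  show "card ?T = m + n"
    by (subst card_Un_disjoint) (auto simp: card_image inj_on_def)
  fix S
  assume S: "general_position_set ?G S"
  let ?C = "S \<inter> {..<2 * n}"
  have one_side: "even x = even y"
    if big: "2 < card ?C" and xy: "x \<in> ?C" "y \<in> ?C" for x y
  proof (rule ccontr)
    assume xy': "even x \<noteq> even y"
    obtain z where z: "z \<in> ?C" "z \<noteq> x" "z \<noteq> y"
    proof -
      have "\<not> ?C \<subseteq> {x, y}"
        using big card_mono[of "{x, y}" ?C] by (auto simp: card_insert_if split: if_splits)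
      then show thesis
        using that by blast
    qed
    \<comment> \<open>\<open>z\<close> shares its side with exactly one of \<open>x\<close> and
      \<open>y\<close>; these two become \<open>u\<close> and \<open>v\<close>, the remaining vertex
      becomes \<open>w\<close>.\<close>
    obtain u v w where uvw: "u \<in> ?C" "v \<in> ?C" "w \<in> ?C" "u \<noteq> v" "even u = even v" "even w \<noteq> even u"
      using xy xy' z by metis
    then obtain p where p: "shortest_path ?G p" "{u, v, w} \<subseteq> set p"
      using crown_geodesic[OF n, of u v w m] by auto
    have "card {u, v, w} \<le> card (set p \<inter> S)"
      using p(2) uvw by (intro card_mono) auto
    moreover have "card {u, v, w} = 3"
      using uvw(4-6) by (auto simp: card_3_iff)
    ultimately have "card (set p \<inter> S) > 2"
      by simp
    then show False
      using S p(1) unfolding general_position_set_def by blast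
  qed
  have "card ?C \<le> n"
  proof (cases "2 < card ?C")
    case True
    \<comment> \<open>Confined to one side, \<open>?C\<close> has at most one vertex in each matched
      pair.\<close>
    have "inj_on (\<lambda>x. x div 2) ?C"
      using one_side[OF True] eq_if_half_parity_eq by (meson inj_onI)
    moreover have "(\<lambda>x. x div 2) ` ?C \<subseteq> {..<n}"
      by auto
    ultimately show ?thesis
      by (metis card_inj_on_le card_lessThan finite_lessThan)
  qed (use n in simp)
  then show "card S \<le> m + n"
    using card_le_crown_part[of S n m] S by (simp add: general_position_set_def)
qed (auto simp: general_position_set_def)

section \<open>Equal numbers, and the theorem\<close>

text \<open>Covers \<open>a = b\<close>, where \<open>b - a + 2\<close> is only 2 and the crown
  would be two disjoint edges, with both numbers equal to 4. Without arcs, paths are single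
  vertices, so all vertices together are in position.\<close>

lemma position_numbers_edgeless:
  "mp_number (with_proj (crown 0 m)) = m" "gp_number (with_proj (crown 0 m)) = m"
proof -
  let ?G = "with_proj (crown 0 m)"
  have short: "card (set p \<inter> {..<m}) \<le> 2" if "vwalk p ?G" for p
    using vwalk_crown_cases[OF that] card_length[of p] card_mono[of "set p" "set p \<inter> {..<m}"]
    by auto
  have "monophonic_position_set ?G {..<m}"
    using short
    by (intro monophonic_position_setI) (auto simp: monophonic_path_def vpath_def)
  moreover have "general_position_set ?G {..<m}"
    using short
    by (auto simp: general_position_set_def shortest_path_def vpath_def not_less)
  moreover have "card S \<le> m" if "S \<subseteq> {..<m}" for S
    using card_mono[OF _ that] by simp
  ultimately show "mp_number ?G = m" "gp_number ?G = m"
    unfolding mp_number_def gp_number_def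
    by (auto intro!: position_number_eqI[where G = ?G and T = "{..<m}"]
        simp: monophonic_position_set_def general_position_set_def)
qed

theorem theorem5p1:
  fixes a b :: nat
  assumes "2 \<le> a" and "a \<le> b"
  shows "\<exists>G :: nat pair_pre_digraph. pair_graph G \<and>
           mp_number (with_proj G) = a \<and> gp_number (with_proj G) = b"
proof (cases "a = b")
  case True
  \<comment> \<open>The witness is \<open>crown 0 a\<close>.\<close>
  then show ?thesis
    using pair_graph_crown position_numbers_edgeless by blast
next
  case False
  \<comment> \<open>\<open>a < b\<close> is exactly what provides three matched pairs.\<close>
  then have n: "3 \<le> b - a + 2"
    using assms by simp
  have "mp_number (with_proj (crown (b - a + 2) (a - 2))) = a"
    "gp_number (with_proj (crown (b - a + 2) (a - 2))) = b"
    using mp_number_crown[OF n] gp_number_crown[OF n] assms by simp_all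
  then show ?thesis
    using pair_graph_crown by blast
qed

end
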